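(* The space $C_k(\omega^*,\omega^* )$ is Choquet and Baire.
   Context: $\omega$ carries the discrete topology, $\beta\omega$ is its Stone–Čech compactification and $\omega^*=\beta\omega\setminus\omega$ is the remainder. $C_k(X,Y)$ denotes the set of continuous functions $X\to Y$ with the compact-open topology, generated by the subbasis of sets $[C,U]=\{f : f(C)\subseteq U\}$ with $C\subseteq X$ compact and $U\subseteq Y$ open. The Choquet game on a space $Z$ is a game of length $\omega$ between players E and NE. The players alternately choose non-empty open sets, E moving first, each set being contained in the set previously chosen by the opponent, giving a descending chain $(U_0,V_0,U_1,V_1,\dots)$ with the $U_i$ played by E and the $V_i$ played by NE. E wins if $\bigcap_i U_i=\bigcap_i V_i$ is empty; otherwise NE wins. $Z$ is Choquet if NE has a winning strategy. $Z$ is Baire if every countable intersection of dense open subsets is dense. *)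

theory Defs
  imports "HOL-Analysis.Analysis"
begin

section \<open>The Stone--Cech compactification of the discrete space omega, and its remainder\<close>

definition ultrafilter :: "'a filter \<Rightarrow> bool" where
  "ultrafilter F \<longleftrightarrow> F \<noteq> bot \<and> (\<forall>P. eventually P F \<or> eventually (\<lambda>x. \<not> P x) F)"

definition beta_basic :: "nat set \<Rightarrow> nat filter set" where
  "beta_basic A = {F. ultrafilter F \<and> eventually (\<lambda>n. n \<in> A) F}"

text \<open>
  The Stone--Cech compactification is modelled by the space of all ultrafilters on
  \<^typ>\<open>nat\<close>, with \<open>n\<close> embedded as the principal ultrafilter at \<open>n\<close>. Theorem
  \<open>beta_omega_Stone_Cech\<close> below confirms that this is the Stone--Cech compactification.
\<close>

definition beta_omega :: "nat filter topology" where
  "beta_omega = topology_generated_by (range beta_basic)"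

definition beta_embed :: "nat \<Rightarrow> nat filter" where
  "beta_embed n = principal {n}"

definition omega_star :: "nat filter topology" where
  "omega_star = subtopology beta_omega (topspace beta_omega - range beta_embed)"


section \<open>Function spaces with the compact-open topology\<close>

text \<open>
  The functions are taken to be extensional, so that distinct elements of
  \<open>continuous_functions X Y\<close> differ at some point of \<^term>\<open>topspace X\<close>.
\<close>

definition continuous_functions :: "'a topology \<Rightarrow> 'b topology \<Rightarrow> ('a \<Rightarrow> 'b) set" where
  "continuous_functions X Y = {f \<in> extensional (topspace X). continuous_map X Y f}"

definition compact_open_subbasic ::
    "'a topology \<Rightarrow> 'b topology \<Rightarrow> 'a set \<Rightarrow> 'b set \<Rightarrow> ('a \<Rightarrow> 'b) set" where
  "compact_open_subbasic X Y C U = {f \<in> continuous_functions X Y. f ` C \<subseteq> U}"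

definition compact_open_topology :: "'a topology \<Rightarrow> 'b topology \<Rightarrow> ('a \<Rightarrow> 'b) topology" where
  "compact_open_topology X Y =
     topology_generated_by {compact_open_subbasic X Y C U |C U. compactin X C \<and> openin Y U}"

lemma topspace_compact_open_topology:
  "topspace (compact_open_topology X Y) = continuous_functions X Y"
proof -
  have "compact_open_subbasic X Y {} {} = continuous_functions X Y"
    by (simp add: compact_open_subbasic_def)
  moreover have "compactin X {}" "openin Y {}" by auto
  ultimately show ?thesis
    unfolding compact_open_topology_def topology_generated_by_topspace
    by (fastforce simp: compact_open_subbasic_def)
qed


section \<open>The Choquet game and Baire spaces\<close>

text \<open>
  A strategy \<open>\<sigma>\<close> for NE maps the list \<open>[U 0, \<dots>, U n]\<close> of the moves made so far by E to
  NE's answer \<open>V n\<close>. This is no restriction compared with strategies that see the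
  whole history, as NE's own earlier moves are determined by \<open>\<sigma>\<close> and the moves of E.
\<close>

definition NE_move :: "('a set list \<Rightarrow> 'a set) \<Rightarrow> (nat \<Rightarrow> 'a set) \<Rightarrow> nat \<Rightarrow> 'a set" where
  "NE_move \<sigma> U n = \<sigma> (map U [0..<Suc n])"

text \<open>
  \<open>E_legal_upto Z \<sigma> U n\<close>: the moves \<open>U 0, \<dots>, U n\<close> of E obey the rules when NE answers by \<open>\<sigma>\<close>.
\<close>

definition E_legal_upto ::
    "'a topology \<Rightarrow> ('a set list \<Rightarrow> 'a set) \<Rightarrow> (nat \<Rightarrow> 'a set) \<Rightarrow> nat \<Rightarrow> bool" where
  "E_legal_upto Z \<sigma> U n \<longleftrightarrow>
     (\<forall>i\<le>n. openin Z (U i) \<and> U i \<noteq> {}) \<and> (\<forall>i<n. U (Suc i) \<subseteq> NE_move \<sigma> U i)"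

text \<open>
  NE has to answer every legal finite sequence of moves of E legally, and to win every
  infinite run.
\<close>

definition NE_winning_strategy :: "'a topology \<Rightarrow> ('a set list \<Rightarrow> 'a set) \<Rightarrow> bool" where
  "NE_winning_strategy Z \<sigma> \<longleftrightarrow>
     (\<forall>U n. E_legal_upto Z \<sigma> U n \<longrightarrow>
        openin Z (NE_move \<sigma> U n) \<and> NE_move \<sigma> U n \<noteq> {} \<and> NE_move \<sigma> U n \<subseteq> U n) \<and>
     (\<forall>U. (\<forall>n. E_legal_upto Z \<sigma> U n) \<longrightarrow> (\<Inter>n. U n) \<noteq> {})"

definition Choquet_space :: "'a topology \<Rightarrow> bool" where
  "Choquet_space Z \<longleftrightarrow> (\<exists>\<sigma>. NE_winning_strategy Z \<sigma>)"

definition Baire_space :: "'a topology \<Rightarrow> bool" where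
  "Baire_space Z \<longleftrightarrow>
     (\<forall>\<G>. countable \<G> \<and> (\<forall>G\<in>\<G>. openin Z G \<and> Z closure_of G = topspace Z)
        \<longrightarrow> Z closure_of (topspace Z \<inter> \<Inter>\<G>) = topspace Z)"


section \<open>The ultrafilter space is the Stone--Cech compactification\<close>

lemma ultrafilter_not_eventually:
  "ultrafilter F \<Longrightarrow> eventually (\<lambda>x. \<not> P x) F \<longleftrightarrow> \<not> eventually P F"
  unfolding ultrafilter_def using eventually_conj[of P F "\<lambda>x. \<not> P x"] by auto

lemma ultrafilter_principal: "ultrafilter (principal {x})"
  by (auto simp: ultrafilter_def eventually_principal principal_eq_bot_iff)

lemma ultrafilter_exists:
  assumes fip: "\<And>T. finite T \<Longrightarrow> T \<subseteq> S \<Longrightarrow> \<Inter>T \<noteq> {}"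
  obtains F where "ultrafilter F" "\<And>A. A \<in> S \<Longrightarrow> eventually (\<lambda>x. x \<in> A) F"
proof -
  define FIP where "FIP M \<longleftrightarrow> (\<forall>T. finite T \<longrightarrow> T \<subseteq> M \<longrightarrow> \<Inter>T \<noteq> {})" for M :: "'a set set"
  have "\<exists>M\<in>{M. S \<subseteq> M \<and> FIP M}. \<forall>X\<in>{M. S \<subseteq> M \<and> FIP M}. M \<subseteq> X \<longrightarrow> X = M"
  proof (rule subset_Zorn_nonempty)
    show "{M. S \<subseteq> M \<and> FIP M} \<noteq> {}"
      using fip by (auto simp: FIP_def)
    fix C assume C: "C \<noteq> {}" "subset.chain {M. S \<subseteq> M \<and> FIP M} C"
    then have sub: "C \<subseteq> {M. S \<subseteq> M \<and> FIP M}" by (simp add: subset.chain_def)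
    have "\<Inter>T \<noteq> {}" if T: "finite T" "T \<subseteq> \<Union>C" for T
    proof -
      obtain M where "M \<in> C" "T \<subseteq> M"
        using finite_subset_Union_chain[OF T C] by blast
      with sub T(1) show ?thesis by (auto simp: FIP_def)
    qed
    then have "FIP (\<Union>C)" by (simp add: FIP_def)
    moreover have "S \<subseteq> \<Union>C" using sub C(1) by blast
    ultimately show "\<Union>C \<in> {M. S \<subseteq> M \<and> FIP M}" by simp
  qed
  then obtain M where M: "S \<subseteq> M" "FIP M"
    and max: "\<And>X. S \<subseteq> X \<Longrightarrow> FIP X \<Longrightarrow> M \<subseteq> X \<Longrightarrow> X = M" by auto
  define F where "F = (INF A\<in>M. principal A)"
  have ev: "eventually (\<lambda>x. x \<in> A) F" if "A \<in> M" for A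
    using that unfolding F_def by (metis INF_lower le_principal)
  have "F \<noteq> bot"
    unfolding F_def
  proof (rule INF_filter_not_bot)
    fix X assume X: "X \<subseteq> M" "finite X"
    have "(INF A\<in>X. principal A) = principal (\<Inter>X)"
      using INF_principal_finite[OF X(2), of id] by simp
    then show "(INF A\<in>X. principal A) \<noteq> bot"
      using X M(2) by (auto simp: FIP_def principal_eq_bot_iff)
  qed
  moreover have "A \<in> M \<or> - A \<in> M" for A
  proof (rule ccontr)
    assume *: "\<not> (A \<in> M \<or> - A \<in> M)"
    have ins: "\<exists>T. finite T \<and> T \<subseteq> M \<and> \<Inter>T \<inter> B = {}" if "B \<notin> M" for B
    proof -
      have "\<not> FIP (insert B M)" using max[of "insert B M"] M(1) that by blast
      then obtain T where T: "finite T" "T \<subseteq> insert B M" "\<Inter>T = {}" by (auto simp: FIP_def)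
      then have "\<Inter>(T - {B}) \<inter> B = {}" by auto
      with T show ?thesis by (intro exI[of _ "T - {B}"]) auto
    qed
    obtain T T' where "finite T" "T \<subseteq> M" "\<Inter>T \<inter> A = {}" "finite T'" "T' \<subseteq> M" "\<Inter>T' \<inter> - A = {}"
      using ins[of A] ins[of "- A"] * by auto
    then have "finite (T \<union> T')" "T \<union> T' \<subseteq> M" "\<Inter>(T \<union> T') = {}"
      unfolding Inter_Un_distrib by blast+
    with M(2) show False unfolding FIP_def by blast
  qed
  then have "eventually P F \<or> eventually (\<lambda>x. \<not> P x) F" for P
    using ev[of "{x. P x}"] ev[of "- {x. P x}"] by auto
  ultimately have "ultrafilter F" by (auto simp: ultrafilter_def)
  with that ev M(1) show thesis by blast
qed

lemma topspace_beta_omega: "topspace beta_omega = {F. ultrafilter F}"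
proof -
  have "{F. ultrafilter F} = beta_basic UNIV" by (simp add: beta_basic_def)
  moreover have "beta_basic A \<subseteq> {F. ultrafilter F}" for A by (auto simp: beta_basic_def)
  ultimately show ?thesis
    unfolding beta_omega_def topology_generated_by_topspace by blast
qed

lemma openin_beta_basic: "openin beta_omega (beta_basic A)"
  unfolding beta_omega_def by (rule topology_generated_by_Basis) simp

lemma beta_basic_Int: "beta_basic A \<inter> beta_basic B = beta_basic (A \<inter> B)"
  by (auto simp: beta_basic_def eventually_conj_iff)

lemma beta_basic_Compl: "beta_basic (- A) = topspace beta_omega - beta_basic A"
  by (auto simp: beta_basic_def topspace_beta_omega ultrafilter_not_eventually)

lemma openin_beta_omega_basic:
  assumes "openin beta_omega W" "F \<in> W"
  obtains A where "F \<in> beta_basic A" "beta_basic A \<subseteq> W"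
proof -
  have "generate_topology_on (range beta_basic) W"
    using assms(1) unfolding beta_omega_def by (rule openin_topology_generated_by)
  then have "\<forall>F\<in>W. \<exists>A. F \<in> beta_basic A \<and> beta_basic A \<subseteq> W"
  proof induction
    case (Int a b)
    show ?case
    proof
      fix F assume "F \<in> a \<inter> b"
      then obtain A B where "F \<in> beta_basic A" "beta_basic A \<subseteq> a" "F \<in> beta_basic B" "beta_basic B \<subseteq> b"
        using Int.IH by blast
      then show "\<exists>A. F \<in> beta_basic A \<and> beta_basic A \<subseteq> a \<inter> b"
        by (intro exI[of _ "A \<inter> B"]) (simp only: beta_basic_Int[symmetric], blast)
    qed
  next
    case (UN K)
    then show ?case by (meson Union_iff Union_upper order_trans)
  qed auto
  with assms(2) that show thesis by blast
qed

lemma compact_space_beta_omega: "compact_space beta_omega"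
  unfolding compact_space_alt
proof (intro allI impI)
  fix \<U> assume U: "(\<forall>U\<in>\<U>. openin beta_omega U) \<and> topspace beta_omega \<subseteq> \<Union>\<U>"
  define S where "S = {- A |A. \<exists>U\<in>\<U>. beta_basic A \<subseteq> U}"
  show "\<exists>\<F>. finite \<F> \<and> \<F> \<subseteq> \<U> \<and> topspace beta_omega \<subseteq> \<Union>\<F>"
  proof (cases "\<exists>T. finite T \<and> T \<subseteq> S \<and> \<Inter>T = {}")
    case True
    then obtain T where T: "finite T" "T \<subseteq> S" "\<Inter>T = {}" by blast
    have "\<exists>U. U \<in> \<U> \<and> beta_basic (- B) \<subseteq> U" if "B \<in> T" for B
    proof -
      have "B \<in> S" using T(2) that by blast
      then obtain A U where "B = - A" "U \<in> \<U>" "beta_basic A \<subseteq> U" unfolding S_def by blast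
      then show ?thesis by auto
    qed
    then obtain u where u: "\<And>B. B \<in> T \<Longrightarrow> u B \<in> \<U> \<and> beta_basic (- B) \<subseteq> u B" by metis
    have "F \<in> \<Union>(u ` T)" if F: "ultrafilter F" for F
    proof (rule ccontr)
      assume "F \<notin> \<Union>(u ` T)"
      then have "\<forall>B\<in>T. F \<notin> beta_basic (- B)" using u by blast
      then have "\<forall>B\<in>T. eventually (\<lambda>n. n \<in> B) F"
        using F by (auto simp: beta_basic_Compl topspace_beta_omega) (auto simp: beta_basic_def)
      then have "eventually (\<lambda>n. \<forall>B\<in>T. n \<in> B) F" using T(1) by (simp add: eventually_ball_finite)
      moreover have "\<not> (\<forall>B\<in>T. n \<in> B)" for n using T(3) by blast
      ultimately have "F = bot" by (simp add: trivial_limit_def)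
      with F show False by (simp add: ultrafilter_def)
    qed
    with T(1) u show ?thesis
      by (intro exI[of _ "u ` T"]) (auto simp: topspace_beta_omega)
  next
    case False
    then obtain F where F: "ultrafilter F" "\<And>A. A \<in> S \<Longrightarrow> eventually (\<lambda>x. x \<in> A) F"
      using ultrafilter_exists[of S] by metis
    then obtain U where "U \<in> \<U>" "F \<in> U" using U by (auto simp: topspace_beta_omega)
    then obtain A where A: "F \<in> beta_basic A" "beta_basic A \<subseteq> U"
      using U openin_beta_omega_basic by metis
    then have "- A \<in> S" using \<open>U \<in> \<U>\<close> by (auto simp: S_def)
    then have "F \<in> beta_basic (- A)"
      using F(1) F(2)[of "- A"] by (simp add: beta_basic_def)
    with A(1) show ?thesis by (simp add: beta_basic_Compl)
  qed
qed

lemma Hausdorff_space_beta_omega: "Hausdorff_space beta_omega"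
  unfolding Hausdorff_space_def
proof (intro allI impI)
  fix F G assume *: "F \<in> topspace beta_omega \<and> G \<in> topspace beta_omega \<and> F \<noteq> G"
  then obtain P where "eventually P F \<noteq> eventually P G" by (auto simp: filter_eq_iff)
  then have "F \<in> beta_basic {n. P n} \<and> G \<in> beta_basic (- {n. P n}) \<or>
             G \<in> beta_basic {n. P n} \<and> F \<in> beta_basic (- {n. P n})"
    using * by (auto simp: beta_basic_def topspace_beta_omega ultrafilter_not_eventually)
  moreover have "disjnt (beta_basic A) (beta_basic (- A))" "disjnt (beta_basic (- A)) (beta_basic A)" for A
    by (auto simp: disjnt_def beta_basic_Compl)
  ultimately show "\<exists>U V. openin beta_omega U \<and> openin beta_omega V \<and> F \<in> U \<and> G \<in> V \<and> disjnt U V"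
    using openin_beta_basic by blast
qed

lemma beta_embed_in_basic: "beta_embed n \<in> beta_basic A \<longleftrightarrow> n \<in> A"
  by (simp add: beta_embed_def beta_basic_def ultrafilter_principal eventually_principal)

lemma embedding_map_beta_embed: "embedding_map (discrete_topology UNIV) beta_omega beta_embed"
proof (rule injective_open_imp_embedding_map)
  show "continuous_map (discrete_topology UNIV) beta_omega beta_embed"
    by (auto simp: topspace_beta_omega beta_embed_def ultrafilter_principal)
  have single: "{beta_embed n} = beta_basic {n}" for n
  proof
    show "beta_basic {n} \<subseteq> {beta_embed n}"
    proof
      fix F assume "F \<in> beta_basic {n}"
      then have F: "ultrafilter F" "eventually (\<lambda>m. m = n) F" by (auto simp: beta_basic_def)
      have "eventually P F \<longleftrightarrow> P n" for P
      proof
        assume "P n" then show "eventually P F" using F(2) by (auto elim: eventually_mono)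
      next
        assume "eventually P F"
        then have "eventually (\<lambda>m. P n) F" using F(2) by eventually_elim auto
        then show "P n" using F(1) by (auto simp: ultrafilter_def)
      qed
      then show "F \<in> {beta_embed n}" by (simp add: filter_eq_iff beta_embed_def eventually_principal)
    qed
  qed (simp add: beta_embed_in_basic)
  show "open_map (discrete_topology UNIV) beta_omega beta_embed"
    unfolding open_map_def
  proof (intro allI impI)
    fix U :: "nat set"
    have "openin beta_omega (\<Union>n\<in>U. beta_basic {n})" using openin_beta_basic by blast
    moreover have "beta_embed ` U = (\<Union>n\<in>U. beta_basic {n})" unfolding single[symmetric] by auto
    ultimately show "openin beta_omega (beta_embed ` U)" by simp
  qed
  show "inj_on beta_embed (topspace (discrete_topology UNIV))"
    by (auto simp: inj_on_def beta_embed_def)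
qed

lemma beta_embed_dense: "beta_omega closure_of (range beta_embed) = topspace beta_omega"
proof -
  have "\<exists>y\<in>range beta_embed. y \<in> T" if "F \<in> T" "openin beta_omega T" for F T
  proof -
    obtain A where A: "F \<in> beta_basic A" "beta_basic A \<subseteq> T"
      using \<open>openin beta_omega T\<close> \<open>F \<in> T\<close> by (rule openin_beta_omega_basic)
    then have "A \<noteq> {}" by (auto simp: beta_basic_def ultrafilter_def)
    then obtain n where "n \<in> A" by auto
    with A show ?thesis using beta_embed_in_basic by blast
  qed
  then show ?thesis unfolding closure_of_def by auto
qed

lemma ultrafilter_limit:
  assumes K: "compact_space K" and f: "range f \<subseteq> topspace K" and F: "ultrafilter F"
  shows "\<exists>l. limitin K f l F"
proof (rule ccontr)
  assume "\<not> ?thesis"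
  then have "\<forall>l\<in>topspace K. \<exists>U. openin K U \<and> l \<in> U \<and> \<not> eventually (\<lambda>x. f x \<in> U) F"
    by (auto simp: limitin_def)
  then obtain u where u: "\<And>l. l \<in> topspace K \<Longrightarrow>
      openin K (u l) \<and> l \<in> u l \<and> \<not> eventually (\<lambda>x. f x \<in> u l) F" by metis
  have "(\<forall>U\<in>u ` topspace K. openin K U) \<and> topspace K \<subseteq> \<Union>(u ` topspace K)" using u by auto
  then obtain \<F> where T: "finite \<F>" "\<F> \<subseteq> u ` topspace K" "topspace K \<subseteq> \<Union>\<F>"
    using K unfolding compact_space_alt by meson
  have "\<forall>U\<in>\<F>. eventually (\<lambda>x. f x \<notin> U) F"
    using T(2) u ultrafilter_not_eventually[OF F] by auto
  then have "eventually (\<lambda>x. \<forall>U\<in>\<F>. f x \<notin> U) F" using T(1) by (simp add: eventually_ball_finite)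
  moreover have "\<not> (\<forall>U\<in>\<F>. f x \<notin> U)" for x using T(3) f by blast
  ultimately have "F = bot" by (simp add: trivial_limit_def)
  with F show False by (simp add: ultrafilter_def)
qed

lemma beta_omega_extension:
  assumes K: "compact_space K" "Hausdorff_space K" and f: "range f \<subseteq> topspace K"
  shows "\<exists>g. continuous_map beta_omega K g \<and> (\<forall>n. g (beta_embed n) = f n)"
proof -
  define g where "g F = (SOME l. limitin K f l F)" for F
  have g: "limitin K f (g F) F" if "ultrafilter F" for F
    unfolding g_def using ultrafilter_limit[OF K(1) f that] by (rule someI_ex)
  have reg: "neighbourhood_base_of (closedin K) K"
    using K compact_Hausdorff_imp_regular_space neighbourhood_base_of_closedin by blast
  have "continuous_map beta_omega K g"
    unfolding continuous_map_def
  proof (intro conjI allI impI)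
    show "g \<in> topspace beta_omega \<rightarrow> topspace K"
      using g by (auto simp: topspace_beta_omega limitin_def)
    fix U assume U: "openin K U"
    show "openin beta_omega {x \<in> topspace beta_omega. g x \<in> U}"
    proof (subst openin_subopen, intro ballI)
      fix F assume "F \<in> {x \<in> topspace beta_omega. g x \<in> U}"
      then have F: "ultrafilter F" "g F \<in> U" by (auto simp: topspace_beta_omega)
      obtain V C where VC: "openin K V" "closedin K C" "g F \<in> V" "V \<subseteq> C" "C \<subseteq> U"
        using reg U F(2) unfolding neighbourhood_base_of by metis
      let ?A = "{n. f n \<in> V}"
      have "F \<in> beta_basic ?A"
        using g[OF F(1)] VC F(1) by (simp add: limitin_def beta_basic_def)
      moreover have "g G \<in> U" if G: "G \<in> beta_basic ?A" for G
      proof (rule ccontr)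
        assume "g G \<notin> U"
        have uG: "ultrafilter G" and ev: "eventually (\<lambda>n. f n \<in> V) G"
          using G by (auto simp: beta_basic_def)
        have "g G \<in> topspace K - C"
          using g[OF uG] \<open>g G \<notin> U\<close> VC by (auto simp: limitin_def)
        then have "eventually (\<lambda>n. f n \<in> topspace K - C) G"
          using limitinD[OF g[OF uG], of "topspace K - C"] VC(2) by (simp add: openin_diff)
        with ev have "eventually (\<lambda>n. False) G"
          by eventually_elim (use VC in auto)
        with uG show False by (simp add: ultrafilter_def)
      qed
      ultimately show "\<exists>T. openin beta_omega T \<and> F \<in> T \<and> T \<subseteq> {x \<in> topspace beta_omega. g x \<in> U}"
        using openin_beta_basic[of ?A] openin_subset by (intro exI[of _ "beta_basic ?A"]) fastforce
    qed
  qed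
  moreover have "g (beta_embed n) = f n" for n
  proof (rule limitin_Hausdorff_unique[OF _ _ _ K(2)])
    show "limitin K f (g (beta_embed n)) (beta_embed n)"
      by (rule g) (simp add: beta_embed_def ultrafilter_principal)
    show "limitin K f (f n) (beta_embed n)"
      using f by (auto simp: limitin_def beta_embed_def eventually_principal)
    show "beta_embed n \<noteq> bot" by (simp add: beta_embed_def principal_eq_bot_iff)
  qed
  ultimately show ?thesis by blast
qed

text \<open>
  The extension is unique, by density of the image of \<^const>\<open>beta_embed\<close> and
  \<open>forall_in_closure_of_eq\<close>.
\<close>

theorem beta_omega_Stone_Cech:
  shows "compact_space beta_omega" "Hausdorff_space beta_omega"
    and "embedding_map (discrete_topology UNIV) beta_omega beta_embed"
    and "beta_omega closure_of (range beta_embed) = topspace beta_omega"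
    and "\<And>(K :: 'k topology) f. compact_space K \<Longrightarrow> Hausdorff_space K \<Longrightarrow>
           continuous_map (discrete_topology UNIV) K f \<Longrightarrow>
           \<exists>g. continuous_map beta_omega K g \<and> (\<forall>n. g (beta_embed n) = f n)"
proof -
  fix K :: "'k topology" and f :: "nat \<Rightarrow> 'k"
  assume "compact_space K" "Hausdorff_space K" "continuous_map (discrete_topology UNIV) K f"
  then show "\<exists>g. continuous_map beta_omega K g \<and> (\<forall>n. g (beta_embed n) = f n)"
    by (intro beta_omega_extension) (auto simp: Pi_iff)
qed (fact compact_space_beta_omega Hausdorff_space_beta_omega embedding_map_beta_embed
       beta_embed_dense)+

end

theory Submission
  imports Defs
begin

text \<open>
  Write \<open>A\<^sup>*\<close> for the clopen subset of \<open>\<omega>\<^sup>*\<close> formed by the free ultrafilters containing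
  \<open>A \<subseteq> \<omega>\<close>. By compactness and zero-dimensionality, the sets of maps that satisfy finitely many
  constraints \<open>f(A\<^sup>*) \<subseteq> D\<^sup>*\<close> form a base of the compact-open topology (\<open>constrained_maps_base\<close>).

  The core of the proof is a countable saturation property: if every finite part of a countable
  family of constraints is satisfied by some map, then one map satisfies all of them
  (\<open>constrained_maps_countably_saturated\<close>). Indeed, let the constraints be \<open>(A\<^sub>i, D\<^sub>i)\<close>. If some map
  satisfies the first \<open>k\<close> of them, then for almost all \<open>m\<close> the intersection of those \<open>D\<^sub>i\<close>, \<open>i < k\<close>,
  with \<open>m \<in> A\<^sub>i\<close> is infinite: otherwise a free ultrafilter concentrated on the exceptional \<open>m\<close>
  would be sent to an ultrafilter containing a finite set. So one can pick \<open>h m \<ge> m\<close> in that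
  intersection, and letting \<open>k\<close> grow slowly with \<open>m\<close> gives a finite-to-one \<open>h : \<omega> \<rightarrow> \<omega>\<close> that maps
  almost all of \<open>A\<^sub>i\<close> into \<open>D\<^sub>i\<close> for every \<open>i\<close>. The map that \<open>h\<close> induces on ultrafilters is
  the required one.

  Hence NE wins the Choquet game by always answering with a nonempty basic set inside E's last
  move: the constraints accumulated during a run are countably many, and finitely many of them are
  satisfied by any map in a sufficiently late move. The Baire property follows by letting E play
  inside one dense open set after another.
\<close>

section \<open>Choquet spaces are Baire\<close>

text \<open>
  Against a winning strategy, E can start inside any nonempty open set \<open>W\<close> and shrink each move to
  the next dense open set; a point surviving the run lies in \<open>W\<close> and in all of them.
\<close>

lemma Choquet_imp_Baire_space:
  assumes "Choquet_space Z"
  shows "Baire_space Z"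
  unfolding Baire_space_def
proof (intro allI impI, elim conjE)
  obtain \<sigma> where \<sigma>: "NE_winning_strategy Z \<sigma>"
    using assms by (auto simp: Choquet_space_def)
  fix \<G> assume cnt: "countable \<G>" and G: "\<forall>G\<in>\<G>. openin Z G \<and> Z closure_of G = topspace Z"
  \<comment> \<open>The whole space is added so that there is something to enumerate when \<open>\<G>\<close> is empty.\<close>
  define g where "g = from_nat_into (insert (topspace Z) \<G>)"
  have rg: "range g = insert (topspace Z) \<G>"
    unfolding g_def using cnt by (intro range_from_nat_into) auto
  have g: "openin Z (g n)" "Z closure_of (g n) = topspace Z" for n
  proof -
    have "g n \<in> insert (topspace Z) \<G>" using rg by blast
    then show "openin Z (g n)" "Z closure_of (g n) = topspace Z" using G by auto
  qed
  have meets: "openin Z (W \<inter> g n) \<and> W \<inter> g n \<noteq> {}" if "openin Z W" "W \<noteq> {}" for W n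
    using that g[of n] by (auto simp: dense_intersects_open)
  have "topspace Z \<inter> \<Inter>\<G> \<inter> W \<noteq> {}" if W: "openin Z W" "W \<noteq> {}" for W
  proof -
    define hist where "hist = rec_nat [W \<inter> g 0] (\<lambda>n h. h @ [\<sigma> h \<inter> g (Suc n)])"
    have hist0: "hist 0 = [W \<inter> g 0]" and histS: "hist (Suc n) = hist n @ [\<sigma> (hist n) \<inter> g (Suc n)]" for n
      by (simp_all add: hist_def)
    define U where "U n = last (hist n)" for n
    have U0: "U 0 = W \<inter> g 0" and US: "U (Suc n) = \<sigma> (hist n) \<inter> g (Suc n)" for n
      by (simp_all add: U_def hist0 histS)
    have hist: "map U [0..<Suc n] = hist n" for n
      by (induction n) (simp_all add: hist0 histS U0 US)
    have move: "NE_move \<sigma> U n = \<sigma> (hist n)" for n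
      unfolding NE_move_def hist ..
    have legal: "E_legal_upto Z \<sigma> U n" for n
    proof (induction n)
      case 0
      show ?case using meets[OF W, of 0] by (simp add: E_legal_upto_def U0)
    next
      case (Suc n)
      then have "openin Z (\<sigma> (hist n))" "\<sigma> (hist n) \<noteq> {}"
        using \<sigma> unfolding NE_winning_strategy_def move[symmetric] by blast+
      then have "openin Z (U (Suc n))" "U (Suc n) \<noteq> {}"
        using meets by (simp_all add: US)
      then show ?case
        using Suc.IH unfolding E_legal_upto_def le_Suc_eq less_Suc_eq move by (auto simp: US)
    qed
    then have "(\<Inter>n. U n) \<noteq> {}"
      using \<sigma> unfolding NE_winning_strategy_def by blast
    then obtain x where x: "x \<in> U n" for n by blast
    have xg: "x \<in> g n" for n
      using x[of n] by (cases n) (auto simp: U0 US)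
    moreover have "x \<in> W" using x[of 0] by (simp add: U0)
    moreover have "x \<in> S" if S: "S \<in> insert (topspace Z) \<G>" for S
    proof -
      obtain n where "S = g n" using S rg by (metis imageE)
      with xg show ?thesis by simp
    qed
    ultimately show ?thesis by blast
  qed
  then show "Z closure_of (topspace Z \<inter> \<Inter>\<G>) = topspace Z"
    by (auto simp: dense_intersects_open)
qed

section \<open>The remainder of omega\<close>

definition star :: "nat set \<Rightarrow> nat filter set" where
  "star A = topspace omega_star \<inter> beta_basic A"

lemma topspace_omega_star:
  "topspace omega_star = {F. ultrafilter F \<and> F \<le> sequentially}"
proof -
  have "F \<in> range beta_embed \<longleftrightarrow> \<not> F \<le> sequentially" if F: "ultrafilter F" for F
  proof
    assume "F \<in> range beta_embed"
    then obtain n where n: "F = principal {n}" by (auto simp: beta_embed_def)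
    have "eventually (\<lambda>m. m \<noteq> n) sequentially"
      using eventually_gt_at_top[of n] by eventually_elim auto
    then show "\<not> F \<le> sequentially"
      by (auto simp: n le_filter_def eventually_principal intro!: exI[of _ "\<lambda>m. m \<noteq> n"])
  next
    assume "\<not> F \<le> sequentially"
    then obtain P where "eventually P sequentially" "\<not> eventually P F"
      by (auto simp: le_filter_def)
    then have fin: "finite {m. \<not> P m}" and ev: "eventually (\<lambda>m. \<not> P m) F"
      using F by (auto simp: ultrafilter_not_eventually cofinite_eq_sequentially[symmetric]
          eventually_cofinite)
    have "\<exists>n. eventually (\<lambda>m. m = n) F"
    proof (rule ccontr)
      assume "\<nexists>n. eventually (\<lambda>m. m = n) F"
      then have "\<forall>n\<in>{m. \<not> P m}. eventually (\<lambda>m. m \<noteq> n) F"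
        using ultrafilter_not_eventually[OF F] by blast
      then have "eventually (\<lambda>m. \<forall>n\<in>{m. \<not> P m}. m \<noteq> n) F"
        using fin by (intro eventually_ball_finite)
      with ev have "eventually (\<lambda>m. False) F" by eventually_elim auto
      with F show False by (simp add: ultrafilter_def)
    qed
    then obtain n where n: "eventually (\<lambda>m. m = n) F" ..
    have "eventually Q F \<longleftrightarrow> Q n" for Q
    proof
      assume "eventually Q F"
      with n have "eventually (\<lambda>m. Q n) F" by eventually_elim auto
      with F show "Q n" by (auto simp: ultrafilter_def)
    qed (use n in \<open>auto elim: eventually_mono\<close>)
    then have "F = beta_embed n"
      by (simp add: filter_eq_iff beta_embed_def eventually_principal)
    then show "F \<in> range beta_embed" by blast
  qed
  then show ?thesis
    by (auto simp: omega_star_def topspace_beta_omega)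
qed

lemma in_star_iff: "F \<in> star A \<longleftrightarrow> F \<in> topspace omega_star \<and> eventually (\<lambda>n. n \<in> A) F"
  by (auto simp: star_def beta_basic_def topspace_omega_star)

lemma ultrafilter_omega_star: "F \<in> topspace omega_star \<Longrightarrow> ultrafilter F"
  by (simp add: topspace_omega_star)

lemma omega_star_infinite:
  assumes F: "F \<in> topspace omega_star" and A: "eventually (\<lambda>n. n \<in> A) F"
  shows "infinite A"
proof
  assume "finite A"
  then have "eventually (\<lambda>n. n \<notin> A) sequentially"
    by (simp add: cofinite_eq_sequentially[symmetric] eventually_cofinite)
  then have "eventually (\<lambda>n. n \<notin> A) F" using F by (auto simp: topspace_omega_star le_filter_def)
  with A have "eventually (\<lambda>n. False) F" by eventually_elim auto
  with F show False by (simp add: topspace_omega_star ultrafilter_def)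
qed

lemma star_nonempty:
  assumes "infinite A"
  shows "star A \<noteq> {}"
proof -
  have "\<Inter>T \<noteq> {}" if T: "finite T" "T \<subseteq> range (\<lambda>k. A \<inter> {k..})" for T
  proof -
    obtain K where K: "finite K" "T = (\<lambda>k. A \<inter> {k..}) ` K"
      using finite_subset_image[OF T] by blast
    obtain n where "n \<in> A" "n \<ge> Max (insert 0 K)"
      using assms unfolding infinite_nat_iff_unbounded_le by blast
    then have "n \<in> \<Inter>T" using K by auto
    then show ?thesis by blast
  qed
  then obtain F where F: "ultrafilter F"
      and ev: "\<And>B. B \<in> range (\<lambda>k. A \<inter> {k..}) \<Longrightarrow> eventually (\<lambda>x. x \<in> B) F"
    using ultrafilter_exists[of "range (\<lambda>k. A \<inter> {k..})"] by blast
  have ev': "eventually (\<lambda>x. x \<in> A \<and> k \<le> x) F" for k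
    using ev[of "A \<inter> {k..}"] by simp
  have "F \<le> sequentially"
    unfolding le_filter_def
  proof (intro allI impI)
    fix P assume "eventually P sequentially"
    then obtain N where "\<forall>n\<ge>N. P n" by (auto simp: eventually_sequentially)
    then show "eventually P F" using ev'[of N] by (auto elim: eventually_mono)
  qed
  moreover have "eventually (\<lambda>x. x \<in> A) F" using ev'[of 0] by simp
  ultimately have "F \<in> star A" using F by (simp add: in_star_iff topspace_omega_star)
  then show ?thesis by blast
qed

lemma openin_star: "openin omega_star (star A)"
proof -
  have "star A = beta_basic A \<inter> topspace omega_star" by (auto simp: star_def)
  then show ?thesis
    unfolding omega_star_def topspace_subtopology
    using openin_beta_basic by (auto simp: openin_subtopology)
qed

lemma openin_omega_star_basic:
  assumes "openin omega_star W" "F \<in> W"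
  obtains A where "F \<in> star A" "star A \<subseteq> W"
proof -
  have F: "F \<in> topspace omega_star" using assms openin_subset by blast
  obtain W' where W': "openin beta_omega W'" "W = W' \<inter> topspace omega_star"
    using assms(1) by (auto simp: omega_star_def openin_subtopology)
  then obtain A where "F \<in> beta_basic A" "beta_basic A \<subseteq> W'"
    using assms(2) openin_beta_omega_basic[of W' F] by blast
  then show thesis using that[of A] W' F by (auto simp: star_def)
qed

lemma compact_space_omega_star: "compact_space omega_star"
proof -
  have "range beta_embed = (\<Union>n. beta_basic {n})"
  proof
    show "range beta_embed \<subseteq> (\<Union>n. beta_basic {n})"
      using beta_embed_in_basic by blast
    show "(\<Union>n. beta_basic {n}) \<subseteq> range beta_embed"
    proof
      fix F assume "F \<in> (\<Union>n. beta_basic {n})"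
      then obtain n where n: "F \<in> beta_basic {n}" by blast
      then have "F \<notin> topspace omega_star"
        using omega_star_infinite[of F "{n}"] by (auto simp: beta_basic_def)
      moreover have "F \<in> topspace beta_omega"
        using n by (auto simp: beta_basic_def topspace_beta_omega)
      ultimately show "F \<in> range beta_embed" by (auto simp: omega_star_def)
    qed
  qed
  then have "openin beta_omega (range beta_embed)" using openin_beta_basic by auto
  then show ?thesis
    unfolding omega_star_def
    by (intro compact_space_subtopology closedin_compact_space compact_space_beta_omega) auto
qed

lemma compactin_star: "compactin omega_star (star A)"
proof (rule closedin_compact_space[OF compact_space_omega_star])
  have "star A = topspace omega_star - star (- A)"
    by (auto simp: in_star_iff ultrafilter_not_eventually[OF ultrafilter_omega_star])
  then show "closedin omega_star (star A)"
    using openin_star by (auto intro: closedin_diff)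
qed

section \<open>Constrained maps\<close>

definition constrained_maps :: "(nat set \<times> nat set) set \<Rightarrow> (nat filter \<Rightarrow> nat filter) set" where
  "constrained_maps P =
     {f \<in> continuous_functions omega_star omega_star. \<forall>(A, D)\<in>P. f ` star A \<subseteq> star D}"

lemma constrained_maps_Un:
  "constrained_maps (P \<union> Q) = constrained_maps P \<inter> constrained_maps Q"
  unfolding constrained_maps_def by blast

lemma constrained_maps_UN:
  "I \<noteq> {} \<Longrightarrow> constrained_maps (\<Union>i\<in>I. P i) = (\<Inter>i\<in>I. constrained_maps (P i))"
  unfolding constrained_maps_def by blast

lemma constrained_maps_antimono: "P \<subseteq> Q \<Longrightarrow> constrained_maps Q \<subseteq> constrained_maps P"
  unfolding constrained_maps_def by blast

lemma openin_constrained_maps: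
  assumes "finite P"
  shows "openin (compact_open_topology omega_star omega_star) (constrained_maps P)"
  using assms
proof induction
  case empty
  then show ?case
    using openin_topspace[of "compact_open_topology omega_star omega_star"]
    by (simp add: constrained_maps_def topspace_compact_open_topology)
next
  case (insert p P)
  obtain A D where p: "p = (A, D)" by fastforce
  have "constrained_maps {p} = compact_open_subbasic omega_star omega_star (star A) (star D)"
    by (auto simp: p constrained_maps_def compact_open_subbasic_def)
  then have "openin (compact_open_topology omega_star omega_star) (constrained_maps {p})"
    unfolding compact_open_topology_def using compactin_star openin_star
    by (intro topology_generated_by_Basis) blast
  with insert.IH show ?case
    using constrained_maps_Un[of "{p}" P] by (auto intro: openin_Int)
qed

text \<open>
  A constraint \<open>f(C) \<subseteq> U\<close> with \<open>C\<close> compact and \<open>U\<close> open can be tested on clopen sets: each point of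
  \<open>C\<close> has a clopen neighbourhood that \<open>f\<close> maps into a clopen subset of \<open>U\<close>, and
  finitely many of these neighbourhoods cover \<open>C\<close>.
\<close>

lemma constrained_maps_base:
  assumes "openin (compact_open_topology omega_star omega_star) W" "f \<in> W"
  shows "\<exists>P. finite P \<and> f \<in> constrained_maps P \<and> constrained_maps P \<subseteq> W"
proof -
  have "generate_topology_on
      {compact_open_subbasic omega_star omega_star C U |C U. compactin omega_star C \<and> openin omega_star U} W"
    using assms(1) unfolding compact_open_topology_def by (rule openin_topology_generated_by)
  then have "\<forall>f\<in>W. \<exists>P. finite P \<and> f \<in> constrained_maps P \<and> constrained_maps P \<subseteq> W"
  proof induction
    case Empty
    then show ?case by simp
  next
    case (Int a b)
    show ?case
    proof
      fix f assume "f \<in> a \<inter> b"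
      then obtain P Q where "finite P" "f \<in> constrained_maps P" "constrained_maps P \<subseteq> a"
        and "finite Q" "f \<in> constrained_maps Q" "constrained_maps Q \<subseteq> b"
        using Int.IH by blast
      then show "\<exists>P. finite P \<and> f \<in> constrained_maps P \<and> constrained_maps P \<subseteq> a \<inter> b"
        by (intro exI[of _ "P \<union> Q"]) (auto simp: constrained_maps_Un)
    qed
  next
    case (UN K)
    then show ?case by (meson Union_iff Union_upper order_trans)
  next
    case (Basis s)
    then obtain C U where s: "s = compact_open_subbasic omega_star omega_star C U"
      and C: "compactin omega_star C" and U: "openin omega_star U" by blast
    show ?case
    proof
      fix f assume "f \<in> s"
      then have f: "f \<in> continuous_functions omega_star omega_star" "f ` C \<subseteq> U"
        by (auto simp: s compact_open_subbasic_def)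
      then have cont: "continuous_map omega_star omega_star f"
        by (simp add: continuous_functions_def)
      have "\<exists>A D. F \<in> star A \<and> f ` star A \<subseteq> star D \<and> star D \<subseteq> U" if FC: "F \<in> C" for F
      proof -
        have F: "F \<in> topspace omega_star" using C FC compactin_subset_topspace by blast
        obtain D where D: "f F \<in> star D" "star D \<subseteq> U"
          using openin_omega_star_basic[OF U, of "f F"] f(2) FC by blast
        have "openin omega_star {G \<in> topspace omega_star. f G \<in> star D}"
          using cont openin_star by (rule openin_continuous_map_preimage)
        moreover have "F \<in> {G \<in> topspace omega_star. f G \<in> star D}" using F D(1) by simp
        ultimately obtain A where "F \<in> star A" "star A \<subseteq> {G \<in> topspace omega_star. f G \<in> star D}"
          by (rule openin_omega_star_basic)
        with D(2) show ?thesis by blast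
      qed
      then obtain A D where AD: "\<And>F. F \<in> C \<Longrightarrow>
          F \<in> star (A F) \<and> f ` star (A F) \<subseteq> star (D F) \<and> star (D F) \<subseteq> U"
        by metis
      have "C \<subseteq> \<Union>((\<lambda>F. star (A F)) ` C)" using AD by blast
      then obtain \<F> where \<F>: "finite \<F>" "\<F> \<subseteq> (\<lambda>F. star (A F)) ` C" "C \<subseteq> \<Union>\<F>"
        using compactinD[OF C, of "(\<lambda>F. star (A F)) ` C"] openin_star by blast
      then obtain K where K: "K \<subseteq> C" "finite K" "\<F> = (\<lambda>F. star (A F)) ` K"
        using finite_subset_image[OF \<F>(1,2)] by blast
      let ?P = "(\<lambda>F. (A F, D F)) ` K"
      have "f \<in> constrained_maps ?P"
        using f(1) AD K(1) by (auto simp: constrained_maps_def)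
      moreover have "constrained_maps ?P \<subseteq> s"
      proof
        fix g assume g: "g \<in> constrained_maps ?P"
        have "g F \<in> U" if FC: "F \<in> C" for F
        proof -
          obtain G where G: "G \<in> K" "F \<in> star (A G)" using \<F>(3) K(3) FC by blast
          then have "g F \<in> star (D G)" using g by (auto simp: constrained_maps_def)
          with G(1) K(1) AD show ?thesis by blast
        qed
        with g show "g \<in> s" by (auto simp: s compact_open_subbasic_def constrained_maps_def)
      qed
      ultimately show "\<exists>P. finite P \<and> f \<in> constrained_maps P \<and> constrained_maps P \<subseteq> s"
        using K(2) by (intro exI[of _ ?P]) simp
    qed
  qed
  with assms(2) show ?thesis by blast
qed

section \<open>Countable saturation\<close>

text \<open>
  An instance of the \<open>\<omega>\<^sub>1\<close>-saturation of reduced powers modulo the cofinite filter: \<open>h m\<close>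
  realises the longest initial segment of the first \<open>m\<close> conditions that is realisable at \<open>m\<close>.
\<close>

lemma diagonal_choice:
  fixes Q :: "nat \<Rightarrow> nat \<Rightarrow> 'a \<Rightarrow> bool"
  assumes "\<And>k. eventually (\<lambda>m. \<exists>n. \<forall>i<k. Q i m n) sequentially"
  shows "\<exists>h. \<forall>i. eventually (\<lambda>m. Q i m (h m)) sequentially"
proof -
  define R where "R m k \<longleftrightarrow> k \<le> m \<and> (\<exists>n. \<forall>i<k. Q i m n)" for m k
  define top_k where "top_k m = (GREATEST k. R m k)" for m
  have bd: "\<And>k. R m k \<Longrightarrow> k \<le> m" for m by (simp add: R_def)
  have "R m 0" for m by (simp add: R_def)
  then have "R m (top_k m)" for m
    unfolding top_k_def using GreatestI_nat[of "R m" 0 m] bd by blast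
  then obtain h where h: "\<And>m i. i < top_k m \<Longrightarrow> Q i m (h m)"
    unfolding R_def by metis
  have "eventually (\<lambda>m. Q i m (h m)) sequentially" for i
    using assms[of "Suc i"] eventually_ge_at_top[of "Suc i"]
  proof eventually_elim
    case (elim m)
    then have "R m (Suc i)" by (simp add: R_def)
    then have "Suc i \<le> top_k m" unfolding top_k_def using Greatest_le_nat[of "R m" "Suc i" m] bd by blast
    then show ?case using h by simp
  qed
  then show ?thesis by blast
qed

text \<open>
  If the set \<open>M\<close> of exceptional \<open>m\<close> were infinite, a free ultrafilter \<open>F\<close> containing \<open>M\<close> would
  decide all the sets \<open>A\<close>. Then \<open>f F\<close> contains the intersection of those \<open>D\<close> with
  \<open>A \<in> F\<close>, and as \<open>f F\<close> is free, this intersection has arbitrarily large elements.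
\<close>

lemma constrained_maps_finite_realisation:
  assumes P: "finite P" and f: "f \<in> constrained_maps P"
  shows "eventually (\<lambda>m. \<exists>n\<ge>m. \<forall>(A, D)\<in>P. m \<in> A \<longrightarrow> n \<in> D) sequentially"
proof (rule ccontr)
  let ?good = "\<lambda>m. \<exists>n\<ge>m. \<forall>(A, D)\<in>P. m \<in> A \<longrightarrow> n \<in> D"
  define M where "M = {m. \<not> ?good m}"
  assume "\<not> eventually ?good sequentially"
  then have "infinite M"
    by (simp add: M_def cofinite_eq_sequentially[symmetric] eventually_cofinite)
  then obtain F where "F \<in> star M" using star_nonempty by blast
  then have F: "F \<in> topspace omega_star" "ultrafilter F" and FM: "eventually (\<lambda>m. m \<in> M) F"
    using ultrafilter_omega_star by (auto simp: in_star_iff)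
  define R where "R = {p \<in> P. eventually (\<lambda>m. m \<in> fst p) F}"
  have "f \<in> topspace omega_star \<rightarrow> topspace omega_star"
    using f by (auto simp: constrained_maps_def continuous_functions_def continuous_map_def)
  then have fF: "f F \<in> topspace omega_star" using F(1) by blast
  have "\<forall>p\<in>R. eventually (\<lambda>n. n \<in> snd p) (f F)"
  proof
    fix p assume "p \<in> R"
    then have "F \<in> star (fst p)" "(fst p, snd p) \<in> P" using F(1) by (auto simp: R_def in_star_iff)
    then have "f F \<in> star (snd p)" using f unfolding constrained_maps_def by blast
    then show "eventually (\<lambda>n. n \<in> snd p) (f F)" by (simp add: in_star_iff)
  qed
  then have "eventually (\<lambda>n. n \<in> {n. \<forall>p\<in>R. n \<in> snd p}) (f F)"
    using P unfolding mem_Collect_eq by (intro eventually_ball_finite) (simp_all add: R_def)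
  then have "infinite {n. \<forall>p\<in>R. n \<in> snd p}" by (rule omega_star_infinite[OF fF])
  then have large: "\<exists>n\<ge>m. \<forall>p\<in>R. n \<in> snd p" for m
    unfolding infinite_nat_iff_unbounded_le by blast
  have "\<forall>p\<in>P - R. eventually (\<lambda>m. m \<notin> fst p) F"
    using ultrafilter_not_eventually[OF F(2)] by (simp add: R_def)
  then have "eventually (\<lambda>m. \<forall>p\<in>P - R. m \<notin> fst p) F"
    using P by (simp add: eventually_ball_finite)
  with FM have "eventually (\<lambda>m. False) F"
  proof eventually_elim
    case (elim m)
    obtain n where "n \<ge> m" "\<forall>p\<in>R. n \<in> snd p" using large by blast
    with elim(2) have "?good m" by (intro exI[of _ n]) force
    with elim(1) show ?case unfolding M_def by blast
  qed
  with F(2) show False by (simp add: ultrafilter_def)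
qed

text \<open>The growth condition on \<open>h\<close> makes the image of a free ultrafilter free.\<close>

lemma filtermap_continuous_functions:
  fixes h :: "nat \<Rightarrow> nat"
  assumes h: "filterlim h sequentially sequentially"
  shows "restrict (filtermap h) (topspace omega_star) \<in> continuous_functions omega_star omega_star"
proof -
  let ?f = "restrict (filtermap h) (topspace omega_star)"
  have maps: "filtermap h F \<in> topspace omega_star" if F: "F \<in> topspace omega_star" for F
  proof -
    have "filtermap h F \<le> filtermap h sequentially"
      using F by (intro filtermap_mono) (simp add: topspace_omega_star)
    also have "\<dots> \<le> sequentially" using h by (simp add: filterlim_def)
    finally have "filtermap h F \<le> sequentially" .
    moreover have "ultrafilter (filtermap h F)"
      using ultrafilter_omega_star[OF F]
      by (simp add: ultrafilter_def eventually_filtermap filtermap_bot_iff)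
    ultimately show ?thesis by (simp add: topspace_omega_star)
  qed
  have pre: "filtermap h F \<in> star A \<longleftrightarrow> F \<in> star (h -` A)" if "F \<in> topspace omega_star" for F A
    using that maps by (simp add: in_star_iff eventually_filtermap)
  have "continuous_map omega_star omega_star ?f"
    unfolding continuous_map_def
  proof (intro conjI allI impI)
    show "?f \<in> topspace omega_star \<rightarrow> topspace omega_star" using maps by auto
    fix U assume U: "openin omega_star U"
    show "openin omega_star {F \<in> topspace omega_star. ?f F \<in> U}"
    proof (subst openin_subopen, intro ballI)
      fix F assume "F \<in> {F \<in> topspace omega_star. ?f F \<in> U}"
      then have F: "F \<in> topspace omega_star" "filtermap h F \<in> U" by auto
      obtain A where A: "filtermap h F \<in> star A" "star A \<subseteq> U"
        using openin_omega_star_basic[OF U F(2)] .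
      have "star (h -` A) \<subseteq> {F \<in> topspace omega_star. ?f F \<in> U}"
      proof
        fix G assume G: "G \<in> star (h -` A)"
        then have "G \<in> topspace omega_star" by (simp add: in_star_iff)
        with G show "G \<in> {F \<in> topspace omega_star. ?f F \<in> U}" using pre A(2) by auto
      qed
      moreover have "F \<in> star (h -` A)" using pre F(1) A(1) by blast
      ultimately show "\<exists>T. openin omega_star T \<and> F \<in> T \<and> T \<subseteq> {F \<in> topspace omega_star. ?f F \<in> U}"
        using openin_star by blast
    qed
  qed
  then show ?thesis by (simp add: continuous_functions_def)
qed

lemma constrained_maps_countably_saturated:
  assumes P: "countable P" and fin: "\<And>Q. finite Q \<Longrightarrow> Q \<subseteq> P \<Longrightarrow> constrained_maps Q \<noteq> {}"
  shows "constrained_maps P \<noteq> {}"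
proof (cases "P = {}")
  case True
  then show ?thesis using fin[of "{}"] by simp
next
  case False
  define p where "p = from_nat_into P"
  have rp: "range p = P" unfolding p_def using range_from_nat_into[OF False P] .
  define Q where "Q i m n \<longleftrightarrow> m \<le> n \<and> (m \<in> fst (p i) \<longrightarrow> n \<in> snd (p i))" for i m n
  have "eventually (\<lambda>m. \<exists>n. \<forall>i<k. Q i m n) sequentially" for k
  proof -
    obtain f where "f \<in> constrained_maps (p ` {..<k})"
      using fin[of "p ` {..<k}"] rp by blast
    from constrained_maps_finite_realisation[OF _ this]
    have "eventually (\<lambda>m. \<exists>n\<ge>m. \<forall>(A, D)\<in>p ` {..<k}. m \<in> A \<longrightarrow> n \<in> D) sequentially" by simp
    then show ?thesis
      by (rule eventually_mono) (force simp: Q_def)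
  qed
  then obtain h where h: "\<And>i. eventually (\<lambda>m. Q i m (h m)) sequentially"
    using diagonal_choice[of Q] by blast
  have "eventually (\<lambda>m. m \<le> h m) sequentially"
    using h[of 0] by eventually_elim (simp add: Q_def)
  then have "filterlim h sequentially sequentially"
    by (rule filterlim_at_top_mono[OF filterlim_ident])
  then obtain f where f: "f \<in> continuous_functions omega_star omega_star"
    and fh: "\<And>F. F \<in> topspace omega_star \<Longrightarrow> f F = filtermap h F"
    using filtermap_continuous_functions restrict_apply' by metis
  have maps: "f \<in> topspace omega_star \<rightarrow> topspace omega_star"
    using f by (simp add: continuous_functions_def continuous_map_def)
  have "f F \<in> star D" if AD: "(A, D) \<in> P" and F: "F \<in> star A" for A D F
  proof -
    have F': "F \<in> topspace omega_star" "eventually (\<lambda>m. m \<in> A) F" using F by (auto simp: in_star_iff)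
    obtain i where i: "p i = (A, D)" using AD rp by (metis imageE)
    have "eventually (\<lambda>m. Q i m (h m)) F"
      using h[of i] F'(1) by (auto simp: topspace_omega_star le_filter_def)
    with F'(2) have "eventually (\<lambda>m. h m \<in> D) F" by eventually_elim (simp add: Q_def i)
    moreover have "f F \<in> topspace omega_star" using maps F'(1) by (rule funcset_mem)
    ultimately show ?thesis using F'(1) by (simp add: fh in_star_iff eventually_filtermap)
  qed
  with f have "f \<in> constrained_maps P" by (auto simp: constrained_maps_def)
  then show ?thesis by blast
qed

section \<open>The Choquet game on the function space\<close>

lemma Choquet_space_omega_star_maps:
  "Choquet_space (compact_open_topology omega_star omega_star)" (is "Choquet_space ?Z")
proof -
  have "\<exists>P. finite P \<and> constrained_maps P \<noteq> {} \<and> constrained_maps P \<subseteq> W"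
    if "openin ?Z W" "W \<noteq> {}" for W
    using constrained_maps_base[OF that(1)] that(2) by blast
  then obtain \<pi> where \<pi>: "\<And>W. openin ?Z W \<Longrightarrow> W \<noteq> {} \<Longrightarrow>
      finite (\<pi> W) \<and> constrained_maps (\<pi> W) \<noteq> {} \<and> constrained_maps (\<pi> W) \<subseteq> W"
    by metis
  define \<sigma> where "\<sigma> Us = constrained_maps (\<pi> (last Us))" for Us
  have move: "NE_move \<sigma> U n = constrained_maps (\<pi> (U n))" for U n
    by (simp add: NE_move_def \<sigma>_def)
  have "NE_winning_strategy ?Z \<sigma>"
    unfolding NE_winning_strategy_def
  proof (intro conjI[where P="\<forall>U n. _ U n"] allI impI)
    fix U n assume "E_legal_upto ?Z \<sigma> U n"
    then have "openin ?Z (U n)" "U n \<noteq> {}" by (auto simp: E_legal_upto_def)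
    then show "openin ?Z (NE_move \<sigma> U n) \<and> NE_move \<sigma> U n \<noteq> {} \<and> NE_move \<sigma> U n \<subseteq> U n"
      using \<pi> by (simp add: move openin_constrained_maps)
  next
    fix U assume legal: "\<forall>n. E_legal_upto ?Z \<sigma> U n"
    then have U: "openin ?Z (U n)" "U n \<noteq> {}" for n by (auto simp: E_legal_upto_def)
    have step: "U (Suc n) \<subseteq> constrained_maps (\<pi> (U n))" for n
      using legal move unfolding E_legal_upto_def by (metis lessI)
    have "U (Suc n) \<subseteq> U n" for n using step \<pi>[OF U] by blast
    then have anti: "U n \<subseteq> U m" if "m \<le> n" for m n using that by (rule lift_Suc_antimono_le)
    have "constrained_maps (\<Union>n. \<pi> (U n)) \<noteq> {}"
    proof (rule constrained_maps_countably_saturated)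
      show "countable (\<Union>n. \<pi> (U n))" using \<pi>[OF U] by (intro countable_UN) (auto intro: countable_finite)
      fix Q assume Q: "finite Q" "Q \<subseteq> (\<Union>n. \<pi> (U n))"
      then have "\<forall>q\<in>Q. \<exists>n. q \<in> \<pi> (U n)" by blast
      then obtain i where "\<forall>q\<in>Q. q \<in> \<pi> (U (i q))" by (rule bchoice[THEN exE])
      moreover define I where "I = i ` Q"
      ultimately have I: "finite I" "Q \<subseteq> (\<Union>n\<in>I. \<pi> (U n))" using Q(1) by auto
      have "U (Suc (Max (insert 0 I))) \<subseteq> constrained_maps (\<pi> (U i))" if "i \<in> I" for i
      proof -
        have "i \<le> Max (insert 0 I)" using I(1) that by simp
        then have "U (Suc (Max (insert 0 I))) \<subseteq> U (Suc i)" by (intro anti) simp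
        with step show ?thesis by blast
      qed
      moreover obtain f where f: "f \<in> U (Suc (Max (insert 0 I)))" using U by blast
      ultimately have "f \<in> constrained_maps (\<pi> (U i))" if "i \<in> I" for i
        using that by blast
      moreover have "f \<in> continuous_functions omega_star omega_star"
        using openin_subset[OF U(1)] f by (auto simp: topspace_compact_open_topology)
      ultimately have "f \<in> constrained_maps (\<Union>n\<in>I. \<pi> (U n))"
        by (simp add: constrained_maps_def)
      with I(2) show "constrained_maps Q \<noteq> {}" using constrained_maps_antimono by blast
    qed
    moreover have "constrained_maps (\<Union>n. \<pi> (U n)) \<subseteq> (\<Inter>n. U n)"
      using \<pi>[OF U] by (auto simp: constrained_maps_UN)
    ultimately show "(\<Inter>n. U n) \<noteq> {}" by blast
  qed
  then show ?thesis by (auto simp: Choquet_space_def)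
qed

theorem corollary5p7:
  shows "Choquet_space (compact_open_topology omega_star omega_star) \<and>
         Baire_space (compact_open_topology omega_star omega_star)"
  using Choquet_space_omega_star_maps Choquet_imp_Baire_space by blast

end
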